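(* Let $\mathcal I$ be an ideal on a set $X$. If $|\mathcal I^\wedge|=n$ is finite, then $\operatorname{dsc}(\mathbb C(X,\mathcal I))=2^n$. Otherwise, $\operatorname{dsc}(\mathbb C(X,\mathcal I))=w(\mathcal I^\wedge)$, where $w(\mathcal I^\wedge)$ denotes the weight of the topological space $\mathcal I^\wedge$.
   Context: An ideal $\mathcal I$ on $X$ is a family of subsets of $X$ closed under finite unions and subsets; it is always assumed that $X\notin\mathcal I$ and that $\mathcal I$ contains all finite subsets of $X$ (so $X$ is infinite). The ballean $\mathbb C(X,\mathcal I)$ has support $\{0,1\}^X$, radii set $\mathcal I$, and for $f\in\{0,1\}^X$ and $A\in\mathcal I$ the ball $B_{\mathbb C}(f,A)=\{g\in\{0,1\}^X\mid g\restriction_{X\setminus A}=f\restriction_{X\setminus A}\}$. The connected component of $f$ is $\bigcup_{A\in\mathcal I}B_{\mathbb C}(f,A)$; these components partition the support, and $\operatorname{dsc}(\mathbb C(X,\mathcal I))$ denotes the (cardinal) number of connected components. $\beta X$ is the Stone–Čech compactification of the discrete space $X$, identified with the set of all ultrafilters on $X$, with base of the topology given by the sets $\overline A=\{p\in\beta X\mid A\in p\}$, $A\subseteq X$. For an ideal $\mathcal I$ let $\varphi_{\mathcal I}=\{X\setminus A\mid A\in\mathcal I\}$ be the dual filter, and let $\mathcal I^\wedge=\bigcap\{\overline A\mid A\in\varphi_{\mathcal I}\}$, i.e., the closed subspace of $\beta X$ consisting of all ultrafilters on $X$ containing $\varphi_{\mathcal I}$, with the subspace topology. The weight of a topological space is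 the least cardinality of a base of its topology. *)

theory Defs
  imports "HOL-Analysis.Analysis"
begin

unbundle cardinal_syntax

section \<open>Ideals and their balleans\<close>

definition set_ideal :: "'a set \<Rightarrow> 'a set set \<Rightarrow> bool" where
  "set_ideal X I \<longleftrightarrow>
     I \<subseteq> Pow X \<and>
     (\<forall>A\<in>I. \<forall>B\<in>I. A \<union> B \<in> I) \<and>
     (\<forall>A\<in>I. \<forall>B. B \<subseteq> A \<longrightarrow> B \<in> I) \<and>
     X \<notin> I \<and>
     (\<forall>F. finite F \<and> F \<subseteq> X \<longrightarrow> F \<in> I)"

record ('s, 'r) ballean =
  support :: "'s set"
  radii :: "'r set"
  bball :: "'s \<Rightarrow> 'r \<Rightarrow> 's set"

definition component :: "('s, 'r) ballean \<Rightarrow> 's \<Rightarrow> 's set" where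
  "component \<B> f = (\<Union>A\<in>radii \<B>. bball \<B> f A)"

text \<open>Cardinals are represented, as in the HOL cardinal library, by well-order relations;
  they are to be compared with \<open>=o\<close>.\<close>

definition dsc :: "('s, 'r) ballean \<Rightarrow> 's set rel" where
  "dsc \<B> = |component \<B> ` support \<B>|"

text \<open>The power \<open>{0,1}\<^sup>X\<close> is the extensional function space, so that functions on the
  carrier \<open>X\<close> are counted without their irrelevant values outside \<open>X\<close>.\<close>

definition cballean :: "'a set \<Rightarrow> 'a set set \<Rightarrow> ('a \<Rightarrow> nat, 'a set) ballean" where
  "cballean X I =
     \<lparr>support = X \<rightarrow>\<^sub>E {0, 1},
      radii = I,
      bball = (\<lambda>f A. {g \<in> X \<rightarrow>\<^sub>E {0, 1}. restrict g (X - A) = restrict f (X - A)})\<rparr>"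


section \<open>The space of ultrafilters\<close>

definition ultrafilter_on :: "'a set \<Rightarrow> 'a set set \<Rightarrow> bool" where
  "ultrafilter_on X p \<longleftrightarrow>
     p \<subseteq> Pow X \<and> X \<in> p \<and> {} \<notin> p \<and>
     (\<forall>A\<in>p. \<forall>B\<in>p. A \<inter> B \<in> p) \<and>
     (\<forall>A\<in>p. \<forall>B. A \<subseteq> B \<and> B \<subseteq> X \<longrightarrow> B \<in> p) \<and>
     (\<forall>A. A \<subseteq> X \<longrightarrow> A \<in> p \<or> X - A \<in> p)"

definition stone_basic :: "'a set \<Rightarrow> 'a set \<Rightarrow> 'a set set set" where
  "stone_basic X A = {p. ultrafilter_on X p \<and> A \<in> p}"

definition stone_cech :: "'a set \<Rightarrow> 'a set set topology" where
  "stone_cech X = topology (arbitrary union_of (\<lambda>U. \<exists>A. A \<subseteq> X \<and> U = stone_basic X A))"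

text \<open>Since \<^const>\<open>topology\<close> is only meaningful on families that are topologies, we check that
  the sets \<^term>\<open>stone_basic X A\<close> do form a base.\<close>

lemma stone_basic_Int:
  assumes "A \<subseteq> X" "B \<subseteq> X"
  shows "stone_basic X A \<inter> stone_basic X B = stone_basic X (A \<inter> B)"
  using assms unfolding stone_basic_def ultrafilter_on_def
  by (auto; metis Int_lower1 Int_lower2)

lemma openin_stone_cech:
  "openin (stone_cech X) = arbitrary union_of (\<lambda>U. \<exists>A. A \<subseteq> X \<and> U = stone_basic X A)"
proof -
  have "istopology (arbitrary union_of (\<lambda>U. \<exists>A. A \<subseteq> X \<and> U = stone_basic X A))"
    by (rule istopology_base) (metis stone_basic_Int inf.coboundedI1)
  then show ?thesis
    unfolding stone_cech_def by (rule topology_inverse')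
qed

lemma topspace_stone_cech: "topspace (stone_cech X) = {p. ultrafilter_on X p}"
proof
  show "topspace (stone_cech X) \<subseteq> {p. ultrafilter_on X p}"
    unfolding topspace_def openin_stone_cech
    by (auto simp: arbitrary_union_of_alt stone_basic_def)
  have "openin (stone_cech X) (stone_basic X X)"
    unfolding openin_stone_cech by (rule arbitrary_union_of_inc) blast
  moreover have "stone_basic X X = {p. ultrafilter_on X p}"
    by (auto simp: stone_basic_def ultrafilter_on_def)
  ultimately show "{p. ultrafilter_on X p} \<subseteq> topspace (stone_cech X)"
    by (metis openin_subset)
qed

definition dual_filter :: "'a set \<Rightarrow> 'a set set \<Rightarrow> 'a set set" where
  "dual_filter X I = {X - A | A. A \<in> I}"

definition ideal_hat :: "'a set \<Rightarrow> 'a set set \<Rightarrow> 'a set set set" where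
  "ideal_hat X I = (\<Inter>A\<in>dual_filter X I. stone_basic X A)"

definition ideal_space :: "'a set \<Rightarrow> 'a set set \<Rightarrow> 'a set set topology" where
  "ideal_space X I = subtopology (stone_cech X) (ideal_hat X I)"


section \<open>Weight of a topological space\<close>

definition base_of :: "'a topology \<Rightarrow> 'a set set \<Rightarrow> bool" where
  "base_of T \<B> \<longleftrightarrow> openin T = arbitrary union_of (\<lambda>U. U \<in> \<B>)"

definition weight :: "'a topology \<Rightarrow> 'a set rel" where
  "weight T = |SOME \<B>. base_of T \<B> \<and> (\<forall>\<B>'. base_of T \<B>' \<longrightarrow> |\<B>| \<le>o |\<B>'| )|"

lemma weight_least:
  obtains \<B> where "base_of T \<B>" "weight T = |\<B>|" "\<And>\<B>'. base_of T \<B>' \<Longrightarrow> weight T \<le>o |\<B>'|"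
proof -
  have "base_of T {U. openin T U}"
    unfolding base_of_def by (auto simp: openin_topology_base_unique)
  then have "\<exists>r\<in>card_of ` {\<B>. base_of T \<B>}. \<forall>r'\<in>card_of ` {\<B>. base_of T \<B>}. r \<le>o r'"
    by (intro exists_minim_Card_order) (auto simp: card_of_Card_order simp del: Field_card_of)
  then have "\<exists>\<B>. base_of T \<B> \<and> (\<forall>\<B>'. base_of T \<B>' \<longrightarrow> |\<B>| \<le>o |\<B>'| )"
    by auto
  from someI_ex[OF this] show ?thesis
    by (intro that) (auto simp: weight_def)
qed

end

(* The component of f is determined by the trace on the space of the clopen set given by
   f = 1, and every such trace occurs, so dsc counts the traces of the standard clopen sets.
   If the space is finite, its traces are all its subsets.  In general the traces form a base,
   and by compactness each trace is a finite union of members of any given base, so that for an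
   infinite space their number is the weight. *)

theory Submission
  imports Defs "HOL-Algebra.Free_Abelian_Groups"
begin

section \<open>Bases, ideals and the existence of ultrafilters\<close>

lemma base_ofD:
  assumes "base_of T \<B>"
  shows base_of_openin: "V \<in> \<B> \<Longrightarrow> openin T V"
    and base_of_neighbourhood: "openin T U \<Longrightarrow> x \<in> U \<Longrightarrow> \<exists>V\<in>\<B>. x \<in> V \<and> V \<subseteq> U"
  using assms unfolding base_of_def openin_topology_base_unique by (simp, meson)

lemma set_idealD:
  assumes "set_ideal X I"
  shows set_ideal_subset: "A \<in> I \<Longrightarrow> A \<subseteq> X"
    and set_ideal_Un: "A \<in> I \<Longrightarrow> B \<in> I \<Longrightarrow> A \<union> B \<in> I"
    and set_ideal_down: "A \<in> I \<Longrightarrow> B \<subseteq> A \<Longrightarrow> B \<in> I"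
    and set_ideal_empty: "{} \<in> I"
proof -
  have X: "I \<subseteq> Pow X" and Un: "\<forall>A\<in>I. \<forall>B\<in>I. A \<union> B \<in> I" and down: "\<forall>A\<in>I. \<forall>B. B \<subseteq> A \<longrightarrow> B \<in> I"
    and fin: "\<forall>F. finite F \<and> F \<subseteq> X \<longrightarrow> F \<in> I"
    using assms unfolding set_ideal_def by simp_all
  show "A \<in> I \<Longrightarrow> A \<subseteq> X" using X by auto
  show "A \<in> I \<Longrightarrow> B \<in> I \<Longrightarrow> A \<union> B \<in> I" using Un by simp
  show "A \<in> I \<Longrightarrow> B \<subseteq> A \<Longrightarrow> B \<in> I" by (rule down[rule_format])
  show "{} \<in> I" using fin by simp
qed

lemma ultrafilter_on_mono: "ultrafilter_on X p \<Longrightarrow> A \<in> p \<Longrightarrow> A \<subseteq> B \<Longrightarrow> B \<subseteq> X \<Longrightarrow> B \<in> p"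
  by (auto simp: ultrafilter_on_def)

lemma ultrafilter_on_Int: "ultrafilter_on X p \<Longrightarrow> A \<in> p \<Longrightarrow> B \<in> p \<Longrightarrow> A \<inter> B \<in> p"
  by (auto simp: ultrafilter_on_def)

lemma ultrafilter_on_Int_iff:
  assumes p: "ultrafilter_on X p" and "A \<subseteq> X" "B \<subseteq> X"
  shows "A \<inter> B \<in> p \<longleftrightarrow> A \<in> p \<and> B \<in> p"
  using assms(2,3) ultrafilter_on_mono[OF p _ Int_lower1, of A B]
    ultrafilter_on_mono[OF p _ Int_lower2, of A B] ultrafilter_on_Int[OF p, of A B]
  by argo

lemma ultrafilter_on_Compl:
  assumes "ultrafilter_on X p" "A \<subseteq> X"
  shows "X - A \<in> p \<longleftrightarrow> A \<notin> p"
proof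
  assume "X - A \<in> p"
  show "A \<notin> p"
  proof
    assume "A \<in> p"
    then have "A \<inter> (X - A) \<in> p" using assms(1) \<open>X - A \<in> p\<close> by (intro ultrafilter_on_Int)
    then show False using assms(1) by (simp add: ultrafilter_on_def)
  qed
next
  assume "A \<notin> p"
  moreover have "\<forall>A. A \<subseteq> X \<longrightarrow> A \<in> p \<or> X - A \<in> p"
    using assms(1) by (simp add: ultrafilter_on_def)
  ultimately show "X - A \<in> p" using assms(2) by blast
qed

lemma ultrafilter_on_Un:
  assumes p: "ultrafilter_on X p" and A: "A \<subseteq> X" and B: "B \<subseteq> X"
  shows "A \<union> B \<in> p \<longleftrightarrow> A \<in> p \<or> B \<in> p"
proof
  assume AB: "A \<union> B \<in> p"
  show "A \<in> p \<or> B \<in> p"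
  proof (rule ccontr)
    assume "\<not> (A \<in> p \<or> B \<in> p)"
    then have "(X - A) \<inter> (X - B) \<in> p"
      using ultrafilter_on_Compl[OF p] A B by (intro ultrafilter_on_Int[OF p]) auto
    then have "X - (A \<union> B) \<in> p" by (simp add: Diff_Un)
    with AB show False using ultrafilter_on_Compl[OF p, of "A \<union> B"] A B by blast
  qed
next
  assume "A \<in> p \<or> B \<in> p"
  then show "A \<union> B \<in> p"
    using ultrafilter_on_mono[OF p, of A "A \<union> B"] ultrafilter_on_mono[OF p, of B "A \<union> B"] A B
    by blast
qed

text \<open>Prime ideal theorem for the power set: Zorn's lemma gives an ideal \<open>M\<close> that
  is maximal among those containing \<open>J\<close> and omitting \<open>A\<close>, and
  \<open>Pow X - M\<close> is the ultrafilter.\<close>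

lemma ultrafilter_avoiding_ideal:
  assumes J: "J \<subseteq> Pow X" "J \<noteq> {}" "\<And>A B. A \<in> J \<Longrightarrow> B \<in> J \<Longrightarrow> A \<union> B \<in> J"
      "\<And>A B. A \<in> J \<Longrightarrow> B \<subseteq> A \<Longrightarrow> B \<in> J"
    and A: "A \<subseteq> X" "A \<notin> J"
  obtains p where "ultrafilter_on X p" "A \<in> p" "p \<inter> J = {}"
proof -
  \<comment> \<open>The condition \<open>A \<notin> K\<close> serves twice: it keeps every member
    proper, and it puts \<open>A\<close> into the complement of a maximal one.\<close>
  define \<A> where "\<A> = {K. J \<subseteq> K \<and> K \<subseteq> Pow X \<and> (\<forall>B\<in>K. \<forall>C\<in>K. B \<union> C \<in> K) \<and>
      (\<forall>B\<in>K. \<forall>C. C \<subseteq> B \<longrightarrow> C \<in> K) \<and> A \<notin> K}"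
  have \<A>I: "K \<in> \<A>" if "J \<subseteq> K" "K \<subseteq> Pow X" "A \<notin> K"
      "\<And>B C. B \<in> K \<Longrightarrow> C \<in> K \<Longrightarrow> B \<union> C \<in> K" "\<And>B C. B \<in> K \<Longrightarrow> C \<subseteq> B \<Longrightarrow> C \<in> K" for K
    unfolding \<A>_def using that by simp
  have \<A>D: "J \<subseteq> K \<and> K \<subseteq> Pow X \<and> A \<notin> K" if "K \<in> \<A>" for K
    using that unfolding \<A>_def by simp
  have \<A>_Un: "B \<union> C \<in> K" if "K \<in> \<A>" "B \<in> K" "C \<in> K" for K B C
    using that unfolding \<A>_def by simp
  have \<A>_down: "C \<in> K" if "K \<in> \<A>" "B \<in> K" "C \<subseteq> B" for K B C
    using that(1) unfolding \<A>_def mem_Collect_eq using that(2,3) by metis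
  have "\<exists>M\<in>\<A>. \<forall>K\<in>\<A>. M \<subseteq> K \<longrightarrow> K = M"
  proof (rule subset_Zorn_nonempty)
    have "J \<in> \<A>" by (rule \<A>I[OF order_refl J(1) A(2) J(3) J(4)])
    then show "\<A> \<noteq> {}" by auto
  next
    fix \<C> assume \<C>: "\<C> \<noteq> {}" "subset.chain \<A> \<C>"
    then have sub: "\<C> \<subseteq> \<A>" and tot: "\<And>K L. K \<in> \<C> \<Longrightarrow> L \<in> \<C> \<Longrightarrow> K \<subseteq> L \<or> L \<subseteq> K"
      by (auto simp: subset_chain_def)
    show "\<Union>\<C> \<in> \<A>"
    proof (rule \<A>I)
      show "B \<union> C \<in> \<Union>\<C>" if BC: "B \<in> \<Union>\<C>" "C \<in> \<Union>\<C>" for B C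
      proof -
        obtain K L where KL: "K \<in> \<C>" "L \<in> \<C>" "B \<in> K" "C \<in> L" using BC by auto
        then obtain M where "M \<in> \<C>" "B \<in> M" "C \<in> M" using tot[of K L] by auto
        then show ?thesis using \<A>_Un[of M B C] sub by (meson UnionI subsetD)
      qed
      show "C \<in> \<Union>\<C>" if "B \<in> \<Union>\<C>" "C \<subseteq> B" for B C
        using that sub \<A>_down[of _ B C] by (meson UnionE UnionI subsetD)
      obtain K where K: "K \<in> \<C>" using \<C>(1) by auto
      then have "J \<subseteq> K" using sub \<A>D[of K] by (simp add: subset_iff)
      with K show "J \<subseteq> \<Union>\<C>" by (rule Union_upper[THEN order_trans[rotated]])
      have "K \<subseteq> Pow X \<and> A \<notin> K" if "K \<in> \<C>" for K
        using \<A>D[of K] that sub by (meson subsetD)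
      then show "\<Union>\<C> \<subseteq> Pow X" "A \<notin> \<Union>\<C>" by (simp_all add: Sup_le_iff)
    qed
  qed
  then obtain M where M: "M \<in> \<A>" and max: "\<And>K. K \<in> \<A> \<Longrightarrow> M \<subseteq> K \<Longrightarrow> K = M" by auto
  have JM: "J \<subseteq> M" and MX: "M \<subseteq> Pow X" and AM: "A \<notin> M"
    using \<A>D[OF M] by auto
  note Un = \<A>_Un[OF M] and down = \<A>_down[OF M]
  have e: "{} \<in> M" using J(2) JM down[OF _ empty_subsetI] by blast
  \<comment> \<open>Maximality is used through the ideal \<open>K\<close> generated by
    \<open>M\<close> and \<open>B\<close>: if it still omitted \<open>A\<close>, it would be a
    member of \<A> properly containing \<open>M\<close>.\<close>
  have ext: "\<exists>D\<in>M. A \<subseteq> D \<union> B" if B: "B \<subseteq> X" "B \<notin> M" for B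
  proof (rule ccontr)
    assume neg: "\<not> (\<exists>D\<in>M. A \<subseteq> D \<union> B)"
    define K where "K = {C. \<exists>D\<in>M. C \<subseteq> D \<union> B}"
    have "M \<subseteq> K" "B \<in> K" using e by (auto simp: K_def)
    moreover have "K \<in> \<A>"
    proof (rule \<A>I)
      show "J \<subseteq> K" using JM \<open>M \<subseteq> K\<close> by (rule order_trans)
      show "K \<subseteq> Pow X" using MX B(1) unfolding K_def by fast
      show "A \<notin> K" using neg unfolding K_def by simp
      show "C \<in> K" if "D \<in> K" "C \<subseteq> D" for D C
        using that unfolding K_def mem_Collect_eq by (meson order_trans)
      show "C \<union> C' \<in> K" if "C \<in> K" "C' \<in> K" for C C'
      proof -
        from that obtain D D' where "D \<in> M" "D' \<in> M" "C \<subseteq> D \<union> B" "C' \<subseteq> D' \<union> B"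
          unfolding K_def by blast
        then have "C \<union> C' \<subseteq> (D \<union> D') \<union> B" "D \<union> D' \<in> M" using Un[of D D'] by auto
        then show ?thesis unfolding K_def by auto
      qed
    qed
    ultimately show False using max[of K] B by simp
  qed
  \<comment> \<open>\<open>M\<close> contains exactly one of \<open>B\<close> and
    \<open>X - B\<close>. Both would put \<open>X\<close>, hence \<open>A\<close>, into
    \<open>M\<close>. If neither is in \<open>M\<close>, then \<open>ext\<close> gives
    \<open>D\<close> covering \<open>A\<close> outside \<open>B\<close> and \<open>D'\<close>
    covering \<open>A\<close> inside \<open>B\<close>, so again \<open>A\<close> would be in
    \<open>M\<close>.\<close>
  have dich: "B \<in> M \<longleftrightarrow> X - B \<notin> M" if B: "B \<subseteq> X" for B
  proof
    show "X - B \<notin> M" if "B \<in> M"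
    proof
      assume "X - B \<in> M"
      with Un[OF that] have "B \<union> (X - B) \<in> M" .
      then show False using down[of "B \<union> (X - B)" A] A(1) AM by auto
    qed
  next
    assume n: "X - B \<notin> M"
    show "B \<in> M"
    proof (rule ccontr)
      assume "B \<notin> M"
      then obtain D where D: "D \<in> M" "A \<subseteq> D \<union> B" using ext B by blast
      obtain D' where D': "D' \<in> M" "A \<subseteq> D' \<union> (X - B)" using ext[of "X - B"] n by auto
      have "A \<subseteq> D \<union> D'" using D D' by auto
      with down[OF Un[OF D(1) D'(1)]] AM show False by simp
    qed
  qed
  define p where "p = Pow X - M"
  have "ultrafilter_on X p"
    unfolding ultrafilter_on_def
  proof (intro conjI ballI allI impI)
    show "p \<subseteq> Pow X" "{} \<notin> p" using e by (auto simp: p_def)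
    show "X \<in> p" using down[of X A] A(1) AM by (auto simp: p_def)
    show "B \<inter> C \<in> p" if "B \<in> p" "C \<in> p" for B C
    proof -
      have BC: "B \<subseteq> X" "B \<notin> M" "C \<subseteq> X" "C \<notin> M" using that by (simp_all add: p_def)
      then have "X - B \<in> M" "X - C \<in> M" using dich[of B] dich[of C] by blast+
      then have "(X - B) \<union> (X - C) \<in> M" by (rule Un)
      then have "X - (B \<inter> C) \<in> M" by (simp only: Diff_Int)
      moreover have "B \<inter> C \<subseteq> X" using BC by blast
      ultimately show ?thesis using dich[of "B \<inter> C"] unfolding p_def by blast
    qed
    show "C \<in> p" if "B \<in> p" "B \<subseteq> C \<and> C \<subseteq> X" for B C
      using that down[of C B] by (auto simp: p_def)
    show "B \<in> p \<or> X - B \<in> p" if "B \<subseteq> X" for B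
      using that dich[of B] by (auto simp: p_def)
  qed
  moreover have "A \<in> p" "p \<inter> J = {}" using A AM JM by (auto simp: p_def)
  ultimately show ?thesis using that by blast
qed

section \<open>Traces of clopen sets and compactness\<close>

text \<open>This is \<open>stone_basic X A\<close> cut down to the subspace
  \<open>ideal_hat X I\<close>.\<close>

definition hat_trace :: "'a set \<Rightarrow> 'a set set \<Rightarrow> 'a set \<Rightarrow> 'a set set set" where
  "hat_trace X I A = {p \<in> ideal_hat X I. A \<in> p}"

text \<open>An ultrafilter contains exactly one of \<open>A\<close> and \<open>X - A\<close>, so
  containing the dual filter amounts to missing the ideal. The form \<open>p \<inter> I = {}\<close>
  is the one that \<open>ultrafilter_avoiding_ideal\<close> delivers.\<close>

lemma mem_ideal_hat:
  assumes "set_ideal X I"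
  shows "p \<in> ideal_hat X I \<longleftrightarrow> ultrafilter_on X p \<and> p \<inter> I = {}"
proof
  assume p: "p \<in> ideal_hat X I"
  then have mem: "ultrafilter_on X p \<and> X - A \<in> p" if "A \<in> I" for A
    using that by (auto simp: ideal_hat_def dual_filter_def stone_basic_def)
  show "ultrafilter_on X p \<and> p \<inter> I = {}"
  proof
    \<comment> \<open>The intersection defining \<open>ideal_hat\<close> says something about
      \<open>p\<close> only if it has an index; the empty set in \<open>I\<close> supplies
      one.\<close>
    show u: "ultrafilter_on X p" using mem set_ideal_empty[OF assms] by auto
    have "A \<notin> p" if "A \<in> I" for A
      using mem[OF that] ultrafilter_on_Compl[OF u set_ideal_subset[OF assms that]] by simp
    then show "p \<inter> I = {}" by auto
  qed
next
  assume "ultrafilter_on X p \<and> p \<inter> I = {}"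
  then have u: "ultrafilter_on X p" and "\<And>A. A \<in> I \<Longrightarrow> A \<notin> p" by auto
  then have "X - A \<in> p" if "A \<in> I" for A
    using ultrafilter_on_Compl[OF u set_ideal_subset[OF assms that]] that by simp
  with u show "p \<in> ideal_hat X I"
    by (auto simp: ideal_hat_def dual_filter_def stone_basic_def)
qed

context
  fixes X :: "'a set" and I :: "'a set set"
  assumes I: "set_ideal X I"
begin

lemma mem_hat_trace: "p \<in> hat_trace X I A \<longleftrightarrow> ultrafilter_on X p \<and> p \<inter> I = {} \<and> A \<in> p"
  by (simp add: hat_trace_def mem_ideal_hat[OF I])

lemma hat_trace_Int: "A \<subseteq> X \<Longrightarrow> B \<subseteq> X \<Longrightarrow> hat_trace X I (A \<inter> B) = hat_trace X I A \<inter> hat_trace X I B"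
  by (auto simp: mem_hat_trace ultrafilter_on_Int_iff)

lemma hat_trace_Un: "A \<subseteq> X \<Longrightarrow> B \<subseteq> X \<Longrightarrow> hat_trace X I (A \<union> B) = hat_trace X I A \<union> hat_trace X I B"
  by (auto simp: mem_hat_trace ultrafilter_on_Un)

lemma hat_trace_empty: "hat_trace X I {} = {}"
  unfolding hat_trace_def using mem_ideal_hat[OF I] by (auto simp: ultrafilter_on_def)

lemma hat_trace_carrier: "hat_trace X I X = ideal_hat X I"
proof -
  have "X \<in> p" if "p \<in> ideal_hat X I" for p
    using that unfolding mem_ideal_hat[OF I] by (simp add: ultrafilter_on_def)
  then show ?thesis unfolding hat_trace_def by auto
qed

lemma hat_trace_Union:
  "finite S \<Longrightarrow> S \<subseteq> Pow X \<Longrightarrow> hat_trace X I (\<Union>S) = (\<Union>A\<in>S. hat_trace X I A)"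
proof (induction S rule: finite_induct)
  case (insert A S)
  then have "A \<subseteq> X" "\<Union>S \<subseteq> X" by auto
  then have "hat_trace X I (A \<union> \<Union>S) = hat_trace X I A \<union> hat_trace X I (\<Union>S)" by (rule hat_trace_Un)
  with insert.IH insert.prems show ?case by simp
qed (simp add: hat_trace_empty)

text \<open>The sets covered, up to a member of \<open>I\<close>, by finitely many members of
  \<open>S\<close> form an ideal \<open>J\<close> that includes both \<open>I\<close> and
  \<open>S\<close>. If \<open>A\<close> were not in \<open>J\<close>, an ultrafilter through
  \<open>A\<close> missing \<open>J\<close> would be a point of the trace of \<open>A\<close> that
  no trace from \<open>S\<close> covers.\<close>

lemma hat_trace_compact:
  assumes A: "A \<subseteq> X" and S: "S \<subseteq> Pow X" and cover: "hat_trace X I A \<subseteq> (\<Union>B\<in>S. hat_trace X I B)"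
  obtains T where "finite T" "T \<subseteq> S" "hat_trace X I A \<subseteq> (\<Union>B\<in>T. hat_trace X I B)"
proof -
  define J where "J = {C. \<exists>T D. finite T \<and> T \<subseteq> S \<and> D \<in> I \<and> C \<subseteq> D \<union> \<Union>T}"
  have JI: "C \<in> J" if "finite T" "T \<subseteq> S" "D \<in> I" "C \<subseteq> D \<union> \<Union>T" for C T D
    unfolding J_def using that by auto
  have JE: "\<exists>T D. finite T \<and> T \<subseteq> S \<and> D \<in> I \<and> C \<subseteq> D \<union> \<Union>T" if "C \<in> J" for C
    using that by (simp add: J_def)
  have IJ: "I \<subseteq> J" using JI[of "{}"] by auto
  have SJ: "S \<subseteq> J"
  proof
    fix B assume "B \<in> S"
    then show "B \<in> J" using set_ideal_empty[OF I] by (intro JI[of "{B}" "{}"]) auto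
  qed
  have "A \<in> J"
  proof (rule ccontr)
    assume "A \<notin> J"
    obtain p where p: "ultrafilter_on X p" "A \<in> p" "p \<inter> J = {}"
    proof (rule ultrafilter_avoiding_ideal[of J X A])
      show "J \<subseteq> Pow X"
      proof
        fix C assume "C \<in> J"
        then obtain T D where T: "T \<subseteq> S" "D \<in> I" "C \<subseteq> D \<union> \<Union>T" using JE by meson
        then have "D \<subseteq> X" "\<Union>T \<subseteq> X" using S set_ideal_subset[OF I] by auto
        with T(3) show "C \<in> Pow X" by auto
      qed
      show "J \<noteq> {}" using IJ set_ideal_empty[OF I] by auto
      show "B \<in> J" if "C \<in> J" "B \<subseteq> C" for C B
        using JE[OF that(1)] JI that(2) by (meson order_trans)
      show "C \<union> C' \<in> J" if CC': "C \<in> J" "C' \<in> J" for C C'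
      proof -
        obtain T D where T: "finite T" "T \<subseteq> S" "D \<in> I" "C \<subseteq> D \<union> \<Union>T"
          using JE[OF CC'(1)] by auto
        obtain T' D' where T': "finite T'" "T' \<subseteq> S" "D' \<in> I" "C' \<subseteq> D' \<union> \<Union>T'"
          using JE[OF CC'(2)] by auto
        show ?thesis
        proof (rule JI)
          show "finite (T \<union> T')" "T \<union> T' \<subseteq> S" using T T' by auto
          show "D \<union> D' \<in> I" using T(3) T'(3) by (rule set_ideal_Un[OF I])
          show "C \<union> C' \<subseteq> (D \<union> D') \<union> \<Union>(T \<union> T')" using T(4) T'(4) by auto
        qed
      qed
    qed (use A \<open>A \<notin> J\<close> in auto)
    then have "p \<in> hat_trace X I A" using IJ by (auto simp: mem_hat_trace)
    then have "p \<in> (\<Union>B\<in>S. hat_trace X I B)" by (rule subsetD[OF cover])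
    then obtain B where "B \<in> S" "B \<in> p" by (auto simp: mem_hat_trace)
    with SJ p(3) show False by auto
  qed
  from JE[OF this] obtain T D where T: "finite T" "T \<subseteq> S" "D \<in> I" "A \<subseteq> D \<union> \<Union>T"
    by auto
  \<comment> \<open>A point containing \<open>A\<close> contains \<open>D \<union> \<Union>T\<close>
    but not \<open>D\<close>, hence contains \<open>\<Union>T\<close>, and by finiteness of
    \<open>T\<close> one of its members.\<close>
  have "hat_trace X I A \<subseteq> (\<Union>B\<in>T. hat_trace X I B)"
  proof
    fix p assume p: "p \<in> hat_trace X I A"
    have sub: "D \<subseteq> X" "\<Union>T \<subseteq> X" using T(2,3) S set_ideal_subset[OF I] by auto
    have "D \<union> \<Union>T \<in> p"
      using p T sub ultrafilter_on_mono[of X p A] by (auto simp: mem_hat_trace)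
    then have "\<Union>T \<in> p"
      using p T sub ultrafilter_on_Un[of X p D "\<Union>T"] by (auto simp: mem_hat_trace)
    then have "p \<in> hat_trace X I (\<Union>T)" using p by (simp add: mem_hat_trace)
    then show "p \<in> (\<Union>B\<in>T. hat_trace X I B)" using hat_trace_Union T S by auto
  qed
  with T that show ?thesis by blast
qed

text \<open>Traces see sets exactly modulo the ideal. If \<open>A - B\<close> is not in
  \<open>I\<close>, some ultrafilter through \<open>A - B\<close> misses \<open>I\<close> and so
  separates the two traces. If it is in \<open>I\<close>, a point containing \<open>A\<close>
  contains \<open>(A - B) \<union> B\<close> and misses the first part.\<close>

lemma hat_trace_subset_iff:
  assumes "A \<subseteq> X" "B \<subseteq> X"
  shows "hat_trace X I A \<subseteq> hat_trace X I B \<longleftrightarrow> A - B \<in> I"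
proof
  assume sub: "hat_trace X I A \<subseteq> hat_trace X I B"
  show "A - B \<in> I"
  proof (rule ccontr)
    assume "A - B \<notin> I"
    obtain p where p: "ultrafilter_on X p" "A - B \<in> p" "p \<inter> I = {}"
    proof (rule ultrafilter_avoiding_ideal[of I X "A - B"])
      show "I \<subseteq> Pow X" "I \<noteq> {}"
        using set_ideal_subset[OF I] set_ideal_empty[OF I] by auto
      show "C \<union> D \<in> I" if "C \<in> I" "D \<in> I" for C D
        by (rule set_ideal_Un[OF I that])
      show "D \<in> I" if "C \<in> I" "D \<subseteq> C" for C D
        by (rule set_ideal_down[OF I that])
    qed (use assms \<open>A - B \<notin> I\<close> in auto)
    then have "A \<in> p" using assms ultrafilter_on_mono[of X p "A - B" A] by auto
    then have "p \<in> hat_trace X I A" using p by (simp add: mem_hat_trace)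
    then have "p \<in> hat_trace X I B" by (rule subsetD[OF sub])
    then have "B \<in> p" by (simp add: mem_hat_trace)
    then have "(A - B) \<inter> B \<in> p" using p ultrafilter_on_Int[of X p "A - B" B] by simp
    moreover have "(A - B) \<inter> B = {}" by blast
    ultimately show False using p by (simp add: ultrafilter_on_def)
  qed
next
  assume AB: "A - B \<in> I"
  show "hat_trace X I A \<subseteq> hat_trace X I B"
  proof
    fix p assume p: "p \<in> hat_trace X I A"
    then have "(A - B) \<union> B \<in> p"
      using assms ultrafilter_on_mono[of X p A "(A - B) \<union> B"] by (auto simp: mem_hat_trace)
    then show "p \<in> hat_trace X I B"
      using p AB assms ultrafilter_on_Un[of X p "A - B" B] by (auto simp: mem_hat_trace)
  qed
qed

section \<open>Connected components correspond to traces\<close>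

text \<open>Two functions lie in one component when their sets of ones have a symmetric difference
  in \<open>I\<close>; \<open>hat_trace_subset_iff\<close>, applied in both directions, turns this
  into equality of traces.\<close>

lemma component_eq_iff:
  assumes f: "f \<in> X \<rightarrow>\<^sub>E {0, 1}" and g: "g \<in> X \<rightarrow>\<^sub>E {0, 1}"
  shows "component (cballean X I) f = component (cballean X I) g
    \<longleftrightarrow> hat_trace X I {x \<in> X. f x = 1} = hat_trace X I {x \<in> X. g x = 1}"
proof -
  \<comment> \<open>Membership in the component of \<open>k\<close> depends on \<open>k\<close> only
    through its trace, so equal traces give equal components. The converse comes from
    \<open>f\<close> lying in its own component.\<close>
  have mem: "h \<in> component (cballean X I) k \<longleftrightarrow>
      hat_trace X I {x \<in> X. h x = 1} = hat_trace X I {x \<in> X. k x = 1}"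
    if h: "h \<in> X \<rightarrow>\<^sub>E {0, 1}" and k: "k \<in> X \<rightarrow>\<^sub>E {0, 1}" for h k
  proof -
    let ?H = "{x \<in> X. h x = 1}" and ?K = "{x \<in> X. k x = 1}"
    have val: "h x = 0 \<or> h x = 1" "k x = 0 \<or> k x = 1" if "x \<in> X" for x
      using h k that by auto
    have "h \<in> component (cballean X I) k \<longleftrightarrow> (\<exists>A\<in>I. restrict h (X - A) = restrict k (X - A))"
      using h by (auto simp: component_def cballean_def)
    also have "\<dots> \<longleftrightarrow> (\<exists>A\<in>I. (?H - ?K) \<union> (?K - ?H) \<subseteq> A)"
    proof (intro bex_cong refl)
      fix A
      have "restrict h (X - A) = restrict k (X - A) \<longleftrightarrow> (\<forall>x\<in>X - A. h x = k x)"
        by (metis restrict_apply' restrict_ext)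
      \<comment> \<open>With only the values 0 and 1 possible, \<open>h\<close> and \<open>k\<close>
        disagree on \<open>X\<close> precisely on this symmetric difference.\<close>
      also have "\<dots> \<longleftrightarrow> (?H - ?K) \<union> (?K - ?H) \<subseteq> A"
        using val by fastforce
      finally show "restrict h (X - A) = restrict k (X - A) \<longleftrightarrow> (?H - ?K) \<union> (?K - ?H) \<subseteq> A" .
    qed
    also have "\<dots> \<longleftrightarrow> ?H - ?K \<in> I \<and> ?K - ?H \<in> I"
      using set_ideal_Un[OF I, of "?H - ?K" "?K - ?H"] set_ideal_down[OF I]
      by (meson Un_upper1 Un_upper2 order_refl order_trans)
    also have "\<dots> \<longleftrightarrow> hat_trace X I ?H \<subseteq> hat_trace X I ?K \<and> hat_trace X I ?K \<subseteq> hat_trace X I ?H"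
      using hat_trace_subset_iff[of ?H ?K] hat_trace_subset_iff[of ?K ?H] by auto
    finally show ?thesis by blast
  qed
  show ?thesis
  proof
    assume "component (cballean X I) f = component (cballean X I) g"
    then show "hat_trace X I {x \<in> X. f x = 1} = hat_trace X I {x \<in> X. g x = 1}"
      using mem[OF f f] mem[OF f g] by simp
  next
    assume eq: "hat_trace X I {x \<in> X. f x = 1} = hat_trace X I {x \<in> X. g x = 1}"
    \<comment> \<open>Components lie inside the support, so their equality has to be tested only on
      functions to which \<open>mem\<close> applies.\<close>
    have "component (cballean X I) k \<subseteq> X \<rightarrow>\<^sub>E {0, 1}" for k
      by (auto simp: component_def cballean_def)
    moreover have "h \<in> component (cballean X I) f \<longleftrightarrow> h \<in> component (cballean X I) g"
      if "h \<in> X \<rightarrow>\<^sub>E {0, 1}" for h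
      unfolding mem[OF that f] mem[OF that g] eq ..
    ultimately show "component (cballean X I) f = component (cballean X I) g"
      by blast
  qed
qed

text \<open>By \<open>component_eq_iff\<close>, sending a component to the trace of any of its
  functions is well defined and injective; characteristic functions make it surjective.\<close>

lemma dsc_cballean: "dsc (cballean X I) =o |hat_trace X I ` Pow X|"
proof -
  let ?E = "X \<rightarrow>\<^sub>E {0, 1::nat}" and ?c = "component (cballean X I)"
    and ?t = "\<lambda>f::'a \<Rightarrow> nat. hat_trace X I {x \<in> X. f x = 1}"
  \<comment> \<open>\<open>F\<close> evaluates the trace at a chosen function generating the
    component; the fact \<open>F\<close> below shows that the choice does not matter.\<close>
  define F where "F K = ?t (SOME f. f \<in> ?E \<and> ?c f = K)" for K
  have F: "F (?c f) = ?t f" if "f \<in> ?E" for f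
  proof -
    have "\<exists>g. g \<in> ?E \<and> ?c g = ?c f" using that by blast
    from someI_ex[OF this] show ?thesis
      using component_eq_iff that unfolding F_def by blast
  qed
  have "bij_betw F (?c ` ?E) (hat_trace X I ` Pow X)"
    unfolding bij_betw_def
  proof
    show "inj_on F (?c ` ?E)"
    proof (rule inj_onI, elim imageE)
      fix K L f g assume "f \<in> ?E" "g \<in> ?E" "K = ?c f" "L = ?c g" "F K = F L"
      then show "K = L" using F[of f] F[of g] component_eq_iff[of f g] by simp
    qed
    show "F ` ?c ` ?E = hat_trace X I ` Pow X"
    proof (intro equalityI subsetI)
      fix U assume "U \<in> F ` ?c ` ?E"
      then obtain f where f: "f \<in> ?E" "U = F (?c f)" by blast
      then have "U = ?t f" using F by simp
      then show "U \<in> hat_trace X I ` Pow X" by auto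
    next
      fix U assume "U \<in> hat_trace X I ` Pow X"
      then obtain A where A: "A \<subseteq> X" "U = hat_trace X I A" by blast
      let ?f = "restrict (\<lambda>x. if x \<in> A then 1 else 0::nat) X"
      have "?f \<in> ?E" by auto
      moreover have "{x \<in> X. ?f x = 1} = A" using A by auto
      ultimately have "F (?c ?f) = U" using F[of ?f] A(2) by simp
      then show "U \<in> F ` ?c ` ?E" using \<open>?f \<in> ?E\<close> by blast
    qed
  qed
  then show ?thesis
    unfolding dsc_def by (auto simp: cballean_def intro: card_of_ordIsoI)
qed

section \<open>Separation of points in finite and infinite spaces\<close>

text \<open>Distinct ultrafilters differ at some subset of \<open>X\<close>; if it belongs to
  \<open>q\<close> instead of \<open>p\<close>, its complement separates in the required
  direction.\<close>

lemma hat_trace_separates: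
  assumes "p \<in> ideal_hat X I" "q \<in> ideal_hat X I" "p \<noteq> q"
  obtains A where "A \<subseteq> X" "p \<in> hat_trace X I A" "q \<notin> hat_trace X I A"
proof -
  have u: "ultrafilter_on X p" "ultrafilter_on X q" using assms mem_ideal_hat[OF I] by auto
  then have "p \<subseteq> Pow X" "q \<subseteq> Pow X" by (auto simp: ultrafilter_on_def)
  then obtain A where A: "A \<subseteq> X" "A \<in> p \<longleftrightarrow> A \<notin> q" using \<open>p \<noteq> q\<close> by blast
  show ?thesis
  proof (cases "A \<in> p")
    case True
    with A assms show ?thesis by (intro that[of A]) (simp_all add: hat_trace_def)
  next
    case False
    with A assms u show ?thesis
      by (intro that[of "X - A"]) (simp_all add: hat_trace_def ultrafilter_on_Compl)
  qed
qed

text \<open>Intersecting the finitely many sets that separate \<open>p\<close> from the other points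
  shows that \<open>{p}\<close> is a trace. Finite unions of such singletons then give every
  subset.\<close>

lemma finite_ideal_hat_traces:
  assumes fin: "finite (ideal_hat X I)"
  shows "hat_trace X I ` Pow X = Pow (ideal_hat X I)"
proof
  show "hat_trace X I ` Pow X \<subseteq> Pow (ideal_hat X I)" by (auto simp: hat_trace_def)
next
  \<comment> \<open>Induction on the set \<open>Q\<close> of points to be avoided, starting from
    \<open>X\<close> and intersecting with one separating set for each new point.\<close>
  have sep: "\<exists>A\<subseteq>X. p \<in> hat_trace X I A \<and> hat_trace X I A \<inter> Q = {}"
    if "finite Q" "Q \<subseteq> ideal_hat X I" "p \<in> ideal_hat X I" "p \<notin> Q" for p Q
    using that
  proof (induction Q rule: finite_induct)
    case empty
    then show ?case using hat_trace_carrier by blast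
  next
    case (insert q Q)
    then obtain A where A: "A \<subseteq> X" "p \<in> hat_trace X I A" "hat_trace X I A \<inter> Q = {}" by auto
    obtain B where B: "B \<subseteq> X" "p \<in> hat_trace X I B" "q \<notin> hat_trace X I B"
      using hat_trace_separates[of p q] insert.prems by blast
    show ?case
      using A B hat_trace_Int by (intro exI[of _ "A \<inter> B"]) auto
  qed
  have "\<exists>A\<subseteq>X. hat_trace X I A = {p}" if p: "p \<in> ideal_hat X I" for p
  proof -
    obtain A where "A \<subseteq> X" "p \<in> hat_trace X I A" "hat_trace X I A \<inter> (ideal_hat X I - {p}) = {}"
      using sep[of "ideal_hat X I - {p}" p] fin p by auto
    moreover have "hat_trace X I A \<subseteq> ideal_hat X I" by (auto simp: hat_trace_def)
    ultimately show ?thesis by blast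
  qed
  then obtain s where s: "\<And>p. p \<in> ideal_hat X I \<Longrightarrow> s p \<subseteq> X \<and> hat_trace X I (s p) = {p}"
    by metis
  show "Pow (ideal_hat X I) \<subseteq> hat_trace X I ` Pow X"
  proof
    fix P assume "P \<in> Pow (ideal_hat X I)"
    then have P: "finite P" "P \<subseteq> ideal_hat X I" using fin finite_subset by auto
    then have "hat_trace X I (\<Union>(s ` P)) = (\<Union>A\<in>s ` P. hat_trace X I A)"
      using s by (intro hat_trace_Union) auto
    also have "\<dots> = P" using s P by auto
    finally show "P \<in> hat_trace X I ` Pow X" using s P by (intro image_eqI[of _ _ "\<Union>(s ` P)"]) auto
  qed
qed

text \<open>Since traces separate points, a point is determined by the traces containing it, so
  finitely many traces would leave only finitely many points.\<close>

lemma infinite_traces: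
  assumes "infinite (ideal_hat X I)"
  shows "infinite (hat_trace X I ` Pow X)"
proof
  assume "finite (hat_trace X I ` Pow X)"
  then have "finite (Pow (hat_trace X I ` Pow X))" by simp
  moreover have "inj_on (\<lambda>p. {U \<in> hat_trace X I ` Pow X. p \<in> U}) (ideal_hat X I)"
  proof (rule inj_onI, rule ccontr)
    fix p q assume pq: "p \<in> ideal_hat X I" "q \<in> ideal_hat X I" "p \<noteq> q"
      and eq: "{U \<in> hat_trace X I ` Pow X. p \<in> U} = {U \<in> hat_trace X I ` Pow X. q \<in> U}"
    obtain A where "A \<subseteq> X" "p \<in> hat_trace X I A" "q \<notin> hat_trace X I A"
      using hat_trace_separates[OF pq] .
    with eq show False by blast
  qed
  ultimately have "finite (ideal_hat X I)"
    by (rule inj_on_finite[rotated 2]) auto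
  with assms show False ..
qed

section \<open>Bases of the space and its weight\<close>

text \<open>The standard clopen base restricts to the subspace. This bounds the weight by the number
  of traces.\<close>

lemma base_of_traces: "base_of (ideal_space X I) (hat_trace X I ` Pow X)"
proof -
  have basic: "stone_basic X A \<inter> ideal_hat X I = hat_trace X I A" for A
    by (auto simp: stone_basic_def hat_trace_def mem_ideal_hat[OF I])
  have base: "base_of (stone_cech X) (stone_basic X ` Pow X)"
    unfolding base_of_def openin_stone_cech by (simp add: image_iff Bex_def)
  show ?thesis
    unfolding base_of_def openin_topology_base_unique ideal_space_def openin_subtopology
  proof (intro conjI allI impI)
    show "\<exists>T. openin (stone_cech X) T \<and> V = T \<inter> ideal_hat X I" if "V \<in> hat_trace X I ` Pow X" for V
      using that base_of_openin[OF base] basic by blast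
    fix U p assume "(\<exists>T. openin (stone_cech X) T \<and> U = T \<inter> ideal_hat X I) \<and> p \<in> U"
    then obtain T where T: "openin (stone_cech X) T" "U = T \<inter> ideal_hat X I" "p \<in> U" by blast
    then obtain A where "A \<subseteq> X" "p \<in> stone_basic X A" "stone_basic X A \<subseteq> T"
      using base_of_neighbourhood[OF base] by blast
    with T basic[of A] show "\<exists>V. V \<in> hat_trace X I ` Pow X \<and> p \<in> V \<and> V \<subseteq> U" by blast
  qed
qed

text \<open>Compactness is available for covers by traces, so the cover of the trace of
  \<open>A\<close> by members of \<B> is refined to traces first. A finite subcover by traces is
  then enlarged back to members of \<B>.\<close>

lemma hat_trace_finite_Union_base:
  assumes \<B>: "base_of (ideal_space X I) \<B>" and A: "A \<subseteq> X"
  shows "\<exists>\<F>\<in>Fpow \<B>. hat_trace X I A = \<Union>\<F>"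
proof -
  note base = base_of_neighbourhood[OF \<B>] and tbase = base_of_neighbourhood[OF base_of_traces]
  define S where "S = {B. B \<subseteq> X \<and> (\<exists>V\<in>\<B>. V \<subseteq> hat_trace X I A \<and> hat_trace X I B \<subseteq> V)}"
  have "hat_trace X I A \<subseteq> (\<Union>B\<in>S. hat_trace X I B)"
  proof
    fix p assume "p \<in> hat_trace X I A"
    moreover have "openin (ideal_space X I) (hat_trace X I A)"
      using A by (intro base_of_openin[OF base_of_traces]) simp
    ultimately obtain V where V: "V \<in> \<B>" "p \<in> V" "V \<subseteq> hat_trace X I A" using base by meson
    from V(2) obtain B where "B \<subseteq> X" "p \<in> hat_trace X I B" "hat_trace X I B \<subseteq> V"
      using tbase[OF base_of_openin[OF \<B> V(1)]] by blast
    with V show "p \<in> (\<Union>B\<in>S. hat_trace X I B)" unfolding S_def by blast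
  qed
  moreover have "S \<subseteq> Pow X" by (auto simp: S_def)
  ultimately obtain T where T: "finite T" "T \<subseteq> S" "hat_trace X I A \<subseteq> (\<Union>B\<in>T. hat_trace X I B)"
    using hat_trace_compact A by metis
  \<comment> \<open>The base set chosen for \<open>B\<close> lies between the trace of
    \<open>B\<close> and that of \<open>A\<close>, so the finitely many chosen sets cover the trace
    of \<open>A\<close> without leaving it.\<close>
  have "\<forall>B\<in>S. \<exists>V. V \<in> \<B> \<and> V \<subseteq> hat_trace X I A \<and> hat_trace X I B \<subseteq> V"
    unfolding S_def by auto
  from bchoice[OF this] obtain v
    where v: "\<And>B. B \<in> S \<Longrightarrow> v B \<in> \<B> \<and> v B \<subseteq> hat_trace X I A \<and> hat_trace X I B \<subseteq> v B"
    by auto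
  have "v ` T \<in> Fpow \<B>" using T v by (auto simp: Fpow_def)
  moreover have "hat_trace X I A = \<Union>(v ` T)" using T v by blast
  ultimately show ?thesis by blast
qed

text \<open>Each trace is the union of a finite subfamily of \<B>, and an infinite set has as many
  finite subsets as elements. A finite \<B> would yield only finitely many unions, against
  \<open>infinite_traces\<close>.\<close>

lemma card_traces_le_base:
  assumes inf: "infinite (ideal_hat X I)" and \<B>: "base_of (ideal_space X I) \<B>"
  shows "|hat_trace X I ` Pow X| \<le>o |\<B>|"
proof -
  have sub: "hat_trace X I ` Pow X \<subseteq> Union ` Fpow \<B>"
  proof
    fix U assume "U \<in> hat_trace X I ` Pow X"
    then obtain A where "A \<subseteq> X" "U = hat_trace X I A" by auto
    with hat_trace_finite_Union_base[OF \<B>] show "U \<in> Union ` Fpow \<B>" by (simp add: image_iff)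
  qed
  have "infinite \<B>"
  proof
    assume "finite \<B>"
    then have "finite (Pow \<B>)" by simp
    then have "finite (Fpow \<B>)" by (rule finite_subset[OF Fpow_subset_Pow])
    then have "finite (hat_trace X I ` Pow X)" by (intro finite_subset[OF sub] finite_imageI)
    with infinite_traces[OF inf] show False ..
  qed
  have "|hat_trace X I ` Pow X| \<le>o |Union ` Fpow \<B>|" using sub by (rule card_of_mono1)
  also have "|Union ` Fpow \<B>| \<le>o |Fpow \<B>|" by (rule card_of_image)
  also have "|Fpow \<B>| =o |\<B>|" using \<open>infinite \<B>\<close> by (rule card_of_Fpow_infinite)
  finally show ?thesis .
qed

end

theorem proposition4p3:
  fixes X :: "'a set" and I :: "'a set set"
  assumes "set_ideal X I"
  shows "(\<forall>n. finite (ideal_hat X I) \<and> card (ideal_hat X I) = n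
              \<longrightarrow> dsc (cballean X I) =o |{..<(2::nat) ^ n}| )
       \<and> (infinite (ideal_hat X I)
              \<longrightarrow> dsc (cballean X I) =o weight (ideal_space X I))"
proof (intro conjI allI impI)
  note dsc = dsc_cballean[OF assms]
  fix n assume n: "finite (ideal_hat X I) \<and> card (ideal_hat X I) = n"
  have "|hat_trace X I ` Pow X| =o |{..<(2::nat) ^ n}|"
    unfolding finite_ideal_hat_traces[OF assms conjunct1[OF n]]
    using n by (intro finite_card_of_iff_card[THEN iffD2]) (auto simp: card_Pow)
  with dsc show "dsc (cballean X I) =o |{..<(2::nat) ^ n}|" by (rule ordIso_transitive)
next
  assume inf: "infinite (ideal_hat X I)"
  obtain \<B> where \<B>: "base_of (ideal_space X I) \<B>" "weight (ideal_space X I) = |\<B>|"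
    and least: "\<And>\<B>'. base_of (ideal_space X I) \<B>' \<Longrightarrow> weight (ideal_space X I) \<le>o |\<B>'|"
    using weight_least by blast
  \<comment> \<open>A base of least size has at least as many members as there are traces;
    conversely the traces are themselves a base.\<close>
  have "|hat_trace X I ` Pow X| =o weight (ideal_space X I)"
    using card_traces_le_base[OF assms inf \<B>(1)] least[OF base_of_traces[OF assms]] \<B>(2)
    by (simp add: ordIso_iff_ordLeq)
  with dsc_cballean[OF assms] show "dsc (cballean X I) =o weight (ideal_space X I)"
    by (rule ordIso_transitive)
qed

end
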